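(* Let $\Sigma_{\mathsf{zkLogin}}$ be the Tagged Witness Signature scheme for the predicate $P_{\mathsf{zkLogin}}$, and let $\mathsf{zkLogin}=(\mathsf{zkLoginGen},\mathsf{zkLoginSign},\mathsf{GetWitness},\mathsf{zkLoginVerify})$ be the scheme constructed from it, both as described in the context. If $\Sigma_{\mathsf{zkLogin}}$ satisfies unforgeability against chosen tag and message attack (i.e. $\Pr[\mathbf{Game}^{\mathsf{EUF\text{-}CTMA}}_{\mathcal{A},\Sigma_{\mathsf{zkLogin}}}(1^\lambda)=1]\le\mathsf{negl}(\lambda)$ for every PPT $\mathcal{A}$), then $\mathsf{zkLogin}$ achieves security: for every PPT adversary $\mathcal{A}$, $\Pr[\mathbf{Game}^{\mathsf{Sec}}_{\mathcal{A},\mathsf{zkLogin}}(1^\lambda)=1]\le\mathsf{negl}(\lambda)$.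
   Context: **Tagged Witness Signature (TWS).** For a predicate $P:\{0,1\}^*\times\{0,1\}^*\to\{0,1\}$ (inputs: public tag $t$, secret witness $w$), a TWS is a triple $(\mathsf{Gen},\mathsf{Sign},\mathsf{Verify})$ with $\mathsf{Gen}(1^\lambda)\to pk$, $\mathsf{Sign}(t,pk,w,m)\to\sigma$, $\mathsf{Verify}(t,pk,m,\sigma)\to 0/1$. **TWS unforgeability game** $\mathbf{Game}^{\mathsf{EUF\text{-}CTMA}}_{\mathcal{A},\mathsf{TWS}}(1^\lambda)$: $pk\gets\mathsf{Gen}(1^\lambda)$; $Q_w,Q_s\gets\emptyset$; $(t^*,m^*,\sigma^* )\gets\mathcal{A}^{\mathcal{O}^{\mathsf{Sign}},\mathcal{O}^{\mathsf{Wit}}}(pk)$; the game returns 1 iff $(t^*,m^* )\notin Q_s$, $t^*\notin Q_w$ and $\mathsf{Verify}(t^*,pk,m^*,\sigma^* )=1$. $\mathcal{O}^{\mathsf{Wit}}(t)$: obtain $w$ with $P(t,w)=1$, set $Q_w\gets Q_w\cup\{t\}$, return $w$. $\mathcal{O}^{\mathsf{Sign}}(t,m)$: obtain $w$ with $P(t,w)=1$, set $\sigma\gets\mathsf{Sign}(t,pk,w,m)$, $Q_s\gets Q_s\cup\{(t,m)\}$, return $\sigma$. **JWTs.** An OpenID Provider (OP), identified by an issuer string $\mathsf{iss}$, is trusted and holds a fixed, honestly generated signing key pair $(sk_{OP},pk_{OP})$; the public key is published (as the "JWK of $\mathsf{iss}$") and is obtained correctly by all parties. $JWT.\mathsf{Issue}(sk_{OP},\mathcal{C})\to\mathsf{jwt}$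 signs a claim set $\mathcal{C}=\{\mathsf{stid},\mathsf{aud},\mathsf{iss},\mathsf{nonce},\dots\}$ (stable user identifier, application identifier, issuer, nonce), and $JWT.\mathsf{Verify}(pk_{OP},\mathsf{jwt})\in\{0,1\}$ checks the signature. $\mathsf{jwt}.x$ denotes the value of claim $x$. $H$ is a hash function and $Sig$ a signature scheme. **Predicate $P_{\mathsf{zkLogin}}$.** For $t=\mathsf{tag}=(pk_{OP},\mathsf{iss},\mathsf{zkaddr},T)$ and $w=(\mathsf{jwt},\mathsf{salt},r,vk_u,sk_u)$, $P_{\mathsf{zkLogin}}(t,w)=1$ iff: $\mathsf{zkaddr}=H(\mathsf{jwt}.\mathsf{stid},\mathsf{jwt}.\mathsf{aud},\mathsf{jwt}.\mathsf{iss},\mathsf{salt})$; $\mathsf{jwt}.\mathsf{iss}=\mathsf{iss}$; $\mathsf{jwt}.\mathsf{nonce}=H(vk_u,T,r)$; $JWT.\mathsf{Verify}(pk_{OP},\mathsf{jwt})=1$; and $(sk_u,vk_u)$ is a valid key pair of $Sig$. **Relation $\mathsf{Ckt}$.** For statement $\mathsf{zkx}=(pk_{OP},\mathsf{iss},\mathsf{zkaddr},T,vk_u)$ and witness $\mathsf{zkw}=(\mathsf{jwt},\mathsf{salt},r)$, $\mathsf{Ckt}(\mathsf{zkx},\mathsf{zkw})$ holds iff: $\mathsf{zkaddr}=H(\mathsf{jwt}.\mathsf{stid},\mathsf{jwt}.\mathsf{aud},\mathsf{jwt}.\mathsf{iss},\mathsf{salt})$; $\mathsf{jwt}.\mathsf{iss}=\mathsf{iss}$;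 $\mathsf{jwt}.\mathsf{nonce}=H(vk_u,T,r)$; and $JWT.\mathsf{Verify}(pk_{OP},\mathsf{jwt})=1$ (validity of a key pair of $Sig$ is not part of this relation). **Scheme $\Sigma_{\mathsf{zkLogin}}$.** Let $\Pi=(\mathsf{Gen},\mathsf{Prove},\mathsf{Verify})$ be a NIZK scheme in the CRS model. - $\mathsf{Gen}(1^\lambda)$: output $pk=zkcrs\gets\Pi.\mathsf{Gen}(1^\lambda,\mathsf{Ckt})$. - $\mathsf{Sign}(\mathsf{tag},pk,w,M)$: parse $\mathsf{tag}=(pk_{OP},\mathsf{iss},\mathsf{zkaddr},T)$, $pk=zkcrs$, $w=(\mathsf{jwt},\mathsf{salt},r,vk_u,sk_u)$; set $\sigma_u\gets Sig.\mathsf{Sign}(sk_u,M)$, $\mathsf{zkx}\gets(pk_{OP},\mathsf{iss},\mathsf{zkaddr},T,vk_u)$, $\mathsf{zkw}\gets(\mathsf{jwt},\mathsf{salt},r)$, $\pi\gets\Pi.\mathsf{Prove}(zkcrs,\mathsf{zkx},\mathsf{zkw})$; output $\sigma=(vk_u,T,\sigma_u,\pi)$. - $\mathsf{Verify}(\mathsf{tag},pk,M,\sigma)$: parse $\mathsf{tag}=(pk_{OP},\mathsf{iss},\mathsf{zkaddr},T)$ and $\sigma=(vk_u,T,\sigma_u,\pi)$ (same $T$); set $\mathsf{zkx}\gets(pk_{OP},\mathsf{iss},\mathsf{zkaddr},T,vk_u)$; accept iff $\sigma_u$ verifies under $Sig$ with key $vk_u$ on $M$, and $\Pi.\mathsf{Verify}(zkcrs,\mathsf{zkx},\pi)=1$.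 **Scheme $\mathsf{zkLogin}$.** - $\mathsf{zkLoginGen}(1^\lambda)$: output $pk\gets\Sigma_{\mathsf{zkLogin}}.\mathsf{Gen}(1^\lambda)$. - $\mathsf{GetWitness}(\mathsf{iss},\mathsf{zkaddr},T_{exp})$: obtain $pk_{OP}$ from the JWK of $\mathsf{iss}$; sample $(vk_u,sk_u)\gets Sig.\mathsf{Gen}(1^\lambda)$ and $r\gets\{0,1\}^\lambda$; set $\mathsf{nonce}\gets H(vk_u,T_{exp},r)$; obtain $\mathsf{stid},\mathsf{aud},\mathsf{salt}$ from the user/app (with $\mathsf{zkaddr}=H(\mathsf{stid},\mathsf{aud},\mathsf{iss},\mathsf{salt})$); obtain $\mathsf{jwt}\gets JWT.\mathsf{Issue}(sk_{OP},\{\mathsf{stid},\mathsf{aud},\mathsf{iss},\mathsf{nonce}\})$ from the OP; output the witness $w\gets(\mathsf{jwt},\mathsf{salt},r,vk_u,sk_u)$ together with $pk_{OP}$. - $\mathsf{zkLoginSign}(pk,\mathsf{zkaddr},\mathsf{iss},M,T_{exp})$: obtain $(w,pk_{OP})\gets\mathsf{GetWitness}(\mathsf{iss},\mathsf{zkaddr},T_{exp})$; let $\mathsf{tag}\gets(pk_{OP},\mathsf{iss},\mathsf{zkaddr},T_{exp})$; output $\Sigma_{\mathsf{zkLogin}}.\mathsf{Sign}(\mathsf{tag},pk,w,M)$. - $\mathsf{zkLoginVerify}(pk,\mathsf{zkaddr},\mathsf{iss},M,\sigma,T_{cur})$: output $0$ if $T_{cur}>\sigma.T$ (where $\sigma.T$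 is the $T$-component of $\sigma$); obtain $pk_{OP}$ from the JWK of $\mathsf{iss}$; let $\mathsf{tag}\gets(pk_{OP},\mathsf{iss},\mathsf{zkaddr},\sigma.T)$; output $\Sigma_{\mathsf{zkLogin}}.\mathsf{Verify}(\mathsf{tag},pk,M,\sigma)$. In the TWS game for $\Sigma_{\mathsf{zkLogin}}$, "obtain $w$" for a tag $(pk_{OP},\mathsf{iss},\mathsf{zkaddr},T)$ is carried out by the procedure $\mathsf{GetWitness}(\mathsf{iss},\mathsf{zkaddr},T)$, and $pk_{OP}$ in tags is the issuer's correct key. Oracle queries are on inputs for which a witness can be so obtained. **Security game** $\mathbf{Game}^{\mathsf{Sec}}_{\mathcal{A},\mathsf{zkLogin}}(1^\lambda)$: $pk\gets\mathsf{zkLoginGen}(1^\lambda)$; $Q_w,Q_s\gets\emptyset$; $(\mathsf{zkaddr}^*,\mathsf{iss}^*,m^*,\sigma^*,T_{cur}^* )\gets\mathcal{A}^{\mathcal{O}^{\mathsf{zkLoginSign}},\mathcal{O}^{\mathsf{GetWitness}}}(pk)$. Let $E$ be the event that $T^*_{cur}>T_{exp}$ for all $T_{exp}$ with $(T_{exp},\mathsf{zkaddr}^*,\mathsf{iss}^* )\in Q_w$, and $F$ the event that $T^*_{cur}>T_{exp}$ for all $T_{exp}$ with $(T_{exp},\mathsf{zkaddr}^*,\mathsf{iss}^*,m^* )\in Q_s$. The game returns $E\wedge F\wedge\mathsf{zkLoginVerify}(pk,\mathsf{zkaddr}^*,\mathsf{iss}^*,m^*,\sigma^*,T^*_{cur})$.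 Oracles: - $\mathcal{O}^{\mathsf{GetWitness}}(\mathsf{iss},\mathsf{zkaddr},T_{exp})$: run $\mathsf{GetWitness}(\mathsf{iss},\mathsf{zkaddr},T_{exp})$ to get $w$; $Q_w\gets Q_w\cup\{(T_{exp},\mathsf{zkaddr},\mathsf{iss})\}$; return $w$. - $\mathcal{O}^{\mathsf{zkLoginSign}}(\mathsf{zkaddr},\mathsf{iss},m,T_{exp})$: $\sigma\gets\mathsf{zkLoginSign}(pk,\mathsf{zkaddr},\mathsf{iss},m,T_{exp})$; $Q_s\gets Q_s\cup\{(T_{exp},\mathsf{zkaddr},\mathsf{iss},m)\}$; return $\sigma$. *)

theory Defs
  imports
    "HOL-Probability.Probability"
    "HOL-Computational_Algebra.Polynomial"
begin

type_synonym bits = "bool list"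

section \<open>Probabilistic machines with oracles\<close>

text \<open>
  Adversaries are uniform probabilistic multi-stack machines, written as structured programs.
  Two stacks give one tape, so up to polynomial overhead these are the probabilistic multi-tape
  Turing machines. A query is a tuple of tuples of bit strings, read from registers; the
  answer is a tuple of bit strings, written to registers. The empty answer stands for failure.
\<close>

type_synonym reg = nat

type_synonym query = "bits list list"

datatype port = Sign_Oracle | Witness_Oracle | JWK_Directory

datatype test = Nonempty reg | Top reg

datatype cmd =
    Skip
  | Push reg bool
  | Pop reg
  | Flip reg
  | Call port "reg list list" "reg list"
  | Seq cmd cmd
  | If_Then_Else test cmd cmd
  | While test cmd

type_synonym 'o oracles = "port \<Rightarrow> query \<Rightarrow> 'o \<Rightarrow> (bits list \<times> 'o) pmf"

type_synonym 'o conf = "(reg \<Rightarrow> bits) \<times> 'o \<times> nat"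

primrec holds :: "test \<Rightarrow> (reg \<Rightarrow> bits) \<Rightarrow> bool" where
  "holds (Nonempty x) s \<longleftrightarrow> s x \<noteq> []"
| "holds (Top x) s \<longleftrightarrow> s x \<noteq> [] \<and> hd (s x)"

fun assign :: "reg list \<Rightarrow> bits list \<Rightarrow> (reg \<Rightarrow> bits) \<Rightarrow> (reg \<Rightarrow> bits)" where
  "assign [] as s = s"
| "assign (y # ys) [] s = assign ys [] (s(y := []))"
| "assign (y # ys) (a # as) s = assign ys as (s(y := a))"

definition total_length :: "query \<Rightarrow> nat" where
  "total_length q = sum_list (map length (concat q))"

context
  fixes guard :: "'s \<Rightarrow> bool" and body :: "'s \<Rightarrow> 's spmf"
begin

partial_function (spmf) while_spmf :: "'s \<Rightarrow> 's spmf" where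
  "while_spmf s = (if guard s then bind_spmf (body s) while_spmf else return_spmf s)"

end

text \<open>
  The last component of a configuration is the elapsed time. Writing a query costs its length, as
  on a query tape; an answer is delivered at once and paid for when it is read or forwarded.
  Mass missing from the resulting subdistribution is the probability of nontermination.
\<close>

primrec exec :: "'o oracles \<Rightarrow> cmd \<Rightarrow> 'o conf \<Rightarrow> 'o conf spmf" where
  "exec orc Skip = (\<lambda>(s, st, n). return_spmf (s, st, n + 1))"
| "exec orc (Push x b) = (\<lambda>(s, st, n). return_spmf (s(x := b # s x), st, n + 1))"
| "exec orc (Pop x) = (\<lambda>(s, st, n). return_spmf (s(x := tl (s x)), st, n + 1))"
| "exec orc (Flip x) = (\<lambda>(s, st, n). map_spmf (\<lambda>b. (s(x := b # s x), st, n + 1)) coin_spmf)"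
| "exec orc (Call i xss ys) = (\<lambda>(s, st, n).
     let q = map (map s) xss in
     map_spmf (\<lambda>(as, st'). (assign ys as s, st', n + 1 + total_length q))
       (spmf_of_pmf (orc i q st)))"
| "exec orc (Seq c d) = (\<lambda>x. bind_spmf (exec orc c x) (exec orc d))"
| "exec orc (If_Then_Else b c d) = (\<lambda>(s, st, n).
     if holds b s then exec orc c (s, st, n + 1) else exec orc d (s, st, n + 1))"
| "exec orc (While b c) = (\<lambda>x.
     map_spmf (\<lambda>(s, st, n). (s, st, n + 1))
       (while_spmf (\<lambda>(s, st, n). holds b s) (\<lambda>(s, st, n). exec orc c (s, st, n + 1)) x))"

text \<open>
  An adversary is a program with the registers that hold its output, a tuple of tuples. It is
  started on the security parameter in unary and the public key; writing the output counts
  towards its running time.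
\<close>

type_synonym adversary = "cmd \<times> reg list list"

definition init_regs :: "nat \<Rightarrow> bits \<Rightarrow> reg \<Rightarrow> bits" where
  "init_regs k pk = (\<lambda>_. [])(0 := replicate k True, 1 := pk)"

definition run_adversary ::
  "adversary \<Rightarrow> 'o oracles \<Rightarrow> nat \<Rightarrow> bits \<Rightarrow> 'o \<Rightarrow> (query \<times> 'o \<times> nat) spmf" where
  "run_adversary A orc k pk st0 =
     map_spmf
       (\<lambda>(s, st, n). let out = map (map s) (snd A) in (out, st, n + total_length out))
       (exec orc (fst A) (init_regs k pk, st0, 0))"

text \<open>
  A game maps the security parameter to the joint distribution of its outcome and the running
  time of the adversary.
\<close>

type_synonym game = "nat \<Rightarrow> (bool \<times> nat) spmf"

definition poly_time :: "game \<Rightarrow> bool" where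
  "poly_time G \<longleftrightarrow> (\<exists>p :: nat poly. \<forall>k.
     lossless_spmf (G k) \<and> (\<forall>(b, n) \<in> set_spmf (G k). n \<le> poly p k))"

definition win_prob :: "game \<Rightarrow> nat \<Rightarrow> real" where
  "win_prob G k = spmf (map_spmf fst (G k)) True"

definition negligible :: "(nat \<Rightarrow> real) \<Rightarrow> bool" where
  "negligible f \<longleftrightarrow> (\<forall>c :: nat. eventually (\<lambda>k. \<bar>f k\<bar> < 1 / real k ^ c) sequentially)"

definition secure :: "(adversary \<Rightarrow> game) \<Rightarrow> bool" where
  "secure G \<longleftrightarrow> (\<forall>A. poly_time (G A) \<longrightarrow> negligible (win_prob (G A)))"

section \<open>Tagged witness signatures\<close>

text \<open>
  Tags, witnesses and signatures are tuples of bit strings; public keys and messages are bit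
  strings. Argument order: \<open>Sign(t, pk, w, m)\<close> and \<open>Verify(t, pk, m, \<sigma>)\<close>.
\<close>

record tws =
  tws_gen :: "nat \<Rightarrow> bits pmf"
  tws_sign :: "bits list \<Rightarrow> bits \<Rightarrow> bits list \<Rightarrow> bits \<Rightarrow> bits list pmf"
  tws_verify :: "bits list \<Rightarrow> bits \<Rightarrow> bits \<Rightarrow> bits list \<Rightarrow> bool"

text \<open>
  The surroundings in which the game is played: trusted key material, sampled once before the game
  and not revealed; a published directory derived from it; the tags that are meaningful under it;
  and the procedure by which the oracles obtain a witness for a tag.
\<close>

record 'e tws_env =
  env_setup :: "nat \<Rightarrow> 'e pmf"
  env_lookup :: "'e \<Rightarrow> bits \<Rightarrow> bits option"
  env_tag :: "'e \<Rightarrow> bits list \<Rightarrow> bool"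
  env_witness :: "nat \<Rightarrow> 'e \<Rightarrow> bits list \<Rightarrow> bits list option pmf"

type_synonym predicate = "nat \<Rightarrow> bits list \<Rightarrow> bits list \<Rightarrow> bool"

definition obtain_witness ::
  "predicate \<Rightarrow> 'e tws_env \<Rightarrow> nat \<Rightarrow> 'e \<Rightarrow> bits list \<Rightarrow> bits list option pmf" where
  "obtain_witness P E k e t =
     (if env_tag E e t
      then map_pmf (\<lambda>r. case r of None \<Rightarrow> None | Some w \<Rightarrow> if P k t w then Some w else None)
             (env_witness E k e t)
      else return_pmf None)"

definition directory_answer :: "(bits \<Rightarrow> bits option) \<Rightarrow> query \<Rightarrow> bits list" where
  "directory_answer dir q =
     (case q of [[x]] \<Rightarrow> (case dir x of None \<Rightarrow> [] | Some y \<Rightarrow> [y]) | _ \<Rightarrow> [])"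

text \<open>The oracles keep \<open>(Q\<^sub>w, Q\<^sub>s)\<close>. Queries for which no witness can be obtained fail.\<close>

type_synonym tws_state = "bits list set \<times> (bits list \<times> bits) set"

definition tws_oracle ::
  "predicate \<Rightarrow> tws \<Rightarrow> 'e tws_env \<Rightarrow> nat \<Rightarrow> 'e \<Rightarrow> bits \<Rightarrow> tws_state oracles" where
  "tws_oracle P S E k e pk i q st = (case i of
     Witness_Oracle \<Rightarrow> (case q of
         [t] \<Rightarrow> bind_pmf (obtain_witness P E k e t) (\<lambda>r. case r of
             None \<Rightarrow> return_pmf ([], st)
           | Some w \<Rightarrow> return_pmf (w, (insert t (fst st), snd st)))
       | _ \<Rightarrow> return_pmf ([], st))
   | Sign_Oracle \<Rightarrow> (case q of
         [t, [m]] \<Rightarrow> bind_pmf (obtain_witness P E k e t) (\<lambda>r. case r of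
             None \<Rightarrow> return_pmf ([], st)
           | Some w \<Rightarrow> bind_pmf (tws_sign S t pk w m) (\<lambda>\<sigma>.
               return_pmf (\<sigma>, (fst st, insert (t, m) (snd st)))))
       | _ \<Rightarrow> return_pmf ([], st))
   | JWK_Directory \<Rightarrow> return_pmf (directory_answer (env_lookup E e) q, st))"

text \<open>
  The forged tag has to be meaningful as well. For zkLogin this means that it carries the correct
  key of its issuer: with a provider key of its own choice an adversary would win trivially.
\<close>

definition tws_wins ::
  "tws \<Rightarrow> 'e tws_env \<Rightarrow> 'e \<Rightarrow> bits \<Rightarrow> query \<Rightarrow> tws_state \<Rightarrow> bool" where
  "tws_wins S E e pk out st = (case out of
     [t, [m], \<sigma>] \<Rightarrow>
       env_tag E e t \<and> (t, m) \<notin> snd st \<and> t \<notin> fst st \<and> tws_verify S t pk m \<sigma>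
   | _ \<Rightarrow> False)"

definition euf_ctma_game ::
  "predicate \<Rightarrow> tws \<Rightarrow> 'e tws_env \<Rightarrow> adversary \<Rightarrow> game" where
  "euf_ctma_game P S E A k =
     bind_spmf (spmf_of_pmf (env_setup E k)) (\<lambda>e.
     bind_spmf (spmf_of_pmf (tws_gen S k)) (\<lambda>pk.
     bind_spmf (run_adversary A (tws_oracle P S E k e pk) k pk ({}, {})) (\<lambda>(out, st, n).
     return_spmf (tws_wins S E e pk out st, n))))"

section \<open>Building blocks\<close>

text \<open>\<open>sig_gen\<close> returns \<open>(vk, sk)\<close>.\<close>

record sig_scheme =
  sig_gen :: "nat \<Rightarrow> (bits \<times> bits) pmf"
  sig_sign :: "bits \<Rightarrow> bits \<Rightarrow> bits pmf"
  sig_verify :: "bits \<Rightarrow> bits \<Rightarrow> bits \<Rightarrow> bool"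

record claims =
  cl_stid :: bits
  cl_aud :: bits
  cl_iss :: bits
  cl_nonce :: bits

text \<open>
  \<open>jwt_gen\<close> returns \<open>(sk, pk)\<close>. The function \<open>jwt_claims\<close> reads the claims off a token, whether or
  not its signature is valid.
\<close>

record jwt_scheme =
  jwt_gen :: "nat \<Rightarrow> (bits \<times> bits) pmf"
  jwt_issue :: "bits \<Rightarrow> claims \<Rightarrow> bits pmf"
  jwt_verify :: "bits \<Rightarrow> bits \<Rightarrow> bool"
  jwt_claims :: "bits \<Rightarrow> claims"

definition jwt_correct :: "jwt_scheme \<Rightarrow> bool" where
  "jwt_correct J \<longleftrightarrow> (\<forall>k C. \<forall>(sk, pk) \<in> set_pmf (jwt_gen J k). \<forall>jwt \<in> set_pmf (jwt_issue J sk C).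
     jwt_verify J pk jwt \<and> jwt_claims J jwt = C)"

text \<open>What efficiency of key generation entails for the size of public keys.\<close>

definition jwt_short_keys :: "jwt_scheme \<Rightarrow> bool" where
  "jwt_short_keys J \<longleftrightarrow>
     (\<exists>p :: nat poly. \<forall>k. \<forall>(sk, pk) \<in> set_pmf (jwt_gen J k). length pk \<le> poly p k)"

record ('x, 'w) nizk =
  nizk_gen :: "nat \<Rightarrow> ('x \<Rightarrow> 'w \<Rightarrow> bool) \<Rightarrow> bits pmf"
  nizk_prove :: "bits \<Rightarrow> 'x \<Rightarrow> 'w \<Rightarrow> bits pmf"
  nizk_verify :: "bits \<Rightarrow> 'x \<Rightarrow> bits \<Rightarrow> bool"

section \<open>zkLogin\<close>

text \<open>\<open>(pk_OP, iss, zkaddr, T, vk_u)\<close> and \<open>(jwt, salt, r)\<close>.\<close>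

type_synonym zkx = "bits \<times> bits \<times> bits \<times> bits \<times> bits"
type_synonym zkw = "bits \<times> bits \<times> bits"

text \<open>
  \<open>issuers\<close> are the issuer strings of the trusted OpenID providers. \<open>account k iss zkaddr\<close> is the
  answer \<open>(stid, aud, salt)\<close> of the user or application owning the address, if there is one.
\<close>

record setting =
  hash :: "nat \<Rightarrow> bits list \<Rightarrow> bits"
  sigs :: sig_scheme
  jwts :: jwt_scheme
  proofs :: "(zkx, zkw) nizk"
  issuers :: "bits set"
  account :: "nat \<Rightarrow> bits \<Rightarrow> bits \<Rightarrow> (bits \<times> bits \<times> bits) option"

definition admissible :: "setting \<Rightarrow> bool" where
  "admissible Z \<longleftrightarrow> finite (issuers Z) \<and> jwt_correct (jwts Z) \<and> jwt_short_keys (jwts Z)"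

definition Ckt :: "setting \<Rightarrow> nat \<Rightarrow> zkx \<Rightarrow> zkw \<Rightarrow> bool" where
  "Ckt Z k = (\<lambda>(pk_OP, iss, zkaddr, T, vk) (jwt, salt, r).
     let C = jwt_claims (jwts Z) jwt in
       zkaddr = hash Z k [cl_stid C, cl_aud C, cl_iss C, salt] \<and>
       cl_iss C = iss \<and>
       cl_nonce C = hash Z k [vk, T, r] \<and>
       jwt_verify (jwts Z) pk_OP jwt)"

definition P_zkLogin :: "setting \<Rightarrow> predicate" where
  "P_zkLogin Z k t w = (case (t, w) of
     ([pk_OP, iss, zkaddr, T], [jwt, salt, r, vk, sk]) \<Rightarrow>
       (let C = jwt_claims (jwts Z) jwt in
         zkaddr = hash Z k [cl_stid C, cl_aud C, cl_iss C, salt] \<and>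
         cl_iss C = iss \<and>
         cl_nonce C = hash Z k [vk, T, r] \<and>
         jwt_verify (jwts Z) pk_OP jwt \<and>
         (vk, sk) \<in> set_pmf (sig_gen (sigs Z) k))
   | _ \<Rightarrow> False)"

definition Sigma_gen :: "setting \<Rightarrow> nat \<Rightarrow> bits pmf" where
  "Sigma_gen Z k = nizk_gen (proofs Z) k (Ckt Z k)"

definition Sigma_sign :: "setting \<Rightarrow> bits list \<Rightarrow> bits \<Rightarrow> bits list \<Rightarrow> bits \<Rightarrow> bits list pmf" where
  "Sigma_sign Z tag crs w M = (case (tag, w) of
     ([pk_OP, iss, zkaddr, T], [jwt, salt, r, vk, sk]) \<Rightarrow>
       bind_pmf (sig_sign (sigs Z) sk M) (\<lambda>\<sigma>u.
       bind_pmf (nizk_prove (proofs Z) crs (pk_OP, iss, zkaddr, T, vk) (jwt, salt, r)) (\<lambda>\<pi>.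
       return_pmf [vk, T, \<sigma>u, \<pi>]))
   | _ \<Rightarrow> return_pmf [])"

definition Sigma_verify :: "setting \<Rightarrow> bits list \<Rightarrow> bits \<Rightarrow> bits \<Rightarrow> bits list \<Rightarrow> bool" where
  "Sigma_verify Z tag crs M \<sigma> = (case (tag, \<sigma>) of
     ([pk_OP, iss, zkaddr, T], [vk, T', \<sigma>u, \<pi>]) \<Rightarrow>
       T' = T \<and>
       sig_verify (sigs Z) vk M \<sigma>u \<and>
       nizk_verify (proofs Z) crs (pk_OP, iss, zkaddr, T, vk) \<pi>
   | _ \<Rightarrow> False)"

definition Sigma_zkLogin :: "setting \<Rightarrow> tws" where
  "Sigma_zkLogin Z =
     \<lparr>tws_gen = Sigma_gen Z, tws_sign = Sigma_sign Z, tws_verify = Sigma_verify Z\<rparr>"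

text \<open>The key pairs \<open>(sk, pk)\<close> of the providers, generated independently and honestly.\<close>

type_synonym op_keys = "bits \<Rightarrow> bits \<times> bits"

definition op_setup :: "setting \<Rightarrow> nat \<Rightarrow> op_keys pmf" where
  "op_setup Z k = Pi_pmf (issuers Z) ([], []) (\<lambda>_. jwt_gen (jwts Z) k)"

definition jwk :: "setting \<Rightarrow> op_keys \<Rightarrow> bits \<Rightarrow> bits option" where
  "jwk Z K iss = (if iss \<in> issuers Z then Some (snd (K iss)) else None)"

definition GetWitness ::
  "setting \<Rightarrow> nat \<Rightarrow> op_keys \<Rightarrow> bits \<Rightarrow> bits \<Rightarrow> bits \<Rightarrow> (bits list \<times> bits) option pmf" where
  "GetWitness Z k K iss zkaddr T_exp =
     (case (jwk Z K iss, account Z k iss zkaddr) of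
       (Some pk_OP, Some (stid, aud, salt)) \<Rightarrow>
         if zkaddr = hash Z k [stid, aud, iss, salt] then
           bind_pmf (sig_gen (sigs Z) k) (\<lambda>(vk, sk).
           bind_pmf (pmf_of_set {r. length r = k}) (\<lambda>r.
           bind_pmf (jwt_issue (jwts Z) (fst (K iss))
             \<lparr>cl_stid = stid, cl_aud = aud, cl_iss = iss, cl_nonce = hash Z k [vk, T_exp, r]\<rparr>) (\<lambda>jwt.
           return_pmf (Some ([jwt, salt, r, vk, sk], pk_OP)))))
         else return_pmf None
     | _ \<Rightarrow> return_pmf None)"

definition zkLogin_tag :: "setting \<Rightarrow> op_keys \<Rightarrow> bits list \<Rightarrow> bool" where
  "zkLogin_tag Z K t = (case t of
     [pk_OP, iss, zkaddr, T] \<Rightarrow> jwk Z K iss = Some pk_OP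
   | _ \<Rightarrow> False)"

definition zkLogin_witness :: "setting \<Rightarrow> nat \<Rightarrow> op_keys \<Rightarrow> bits list \<Rightarrow> bits list option pmf" where
  "zkLogin_witness Z k K t = (case t of
     [pk_OP, iss, zkaddr, T] \<Rightarrow> map_pmf (map_option fst) (GetWitness Z k K iss zkaddr T)
   | _ \<Rightarrow> return_pmf None)"

definition zkLogin_env :: "setting \<Rightarrow> op_keys tws_env" where
  "zkLogin_env Z =
     \<lparr>env_setup = op_setup Z, env_lookup = jwk Z,
      env_tag = zkLogin_tag Z, env_witness = zkLogin_witness Z\<rparr>"

definition zkLoginGen :: "setting \<Rightarrow> nat \<Rightarrow> bits pmf" where
  "zkLoginGen Z k = tws_gen (Sigma_zkLogin Z) k"

definition zkLoginSign ::
  "setting \<Rightarrow> nat \<Rightarrow> op_keys \<Rightarrow> bits \<Rightarrow> bits \<Rightarrow> bits \<Rightarrow> bits \<Rightarrow> bits \<Rightarrow> bits list option pmf" where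
  "zkLoginSign Z k K pk zkaddr iss M T_exp =
     bind_pmf (GetWitness Z k K iss zkaddr T_exp) (\<lambda>r. case r of
         None \<Rightarrow> return_pmf None
       | Some (w, pk_OP) \<Rightarrow>
           map_pmf Some (tws_sign (Sigma_zkLogin Z) [pk_OP, iss, zkaddr, T_exp] pk w M))"

text \<open>Times are bit strings, compared as binary numbers, least significant bit first.\<close>

definition time_value :: "bits \<Rightarrow> nat" where
  "time_value T = horner_sum of_bool 2 T"

definition zkLoginVerify ::
  "setting \<Rightarrow> op_keys \<Rightarrow> bits \<Rightarrow> bits \<Rightarrow> bits \<Rightarrow> bits \<Rightarrow> bits list \<Rightarrow> bits \<Rightarrow> bool" where
  "zkLoginVerify Z K pk zkaddr iss M \<sigma> T_cur = (case \<sigma> of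
     [vk, T, \<sigma>u, \<pi>] \<Rightarrow>
       \<not> time_value T_cur > time_value T \<and>
       (case jwk Z K iss of
          None \<Rightarrow> False
        | Some pk_OP \<Rightarrow> tws_verify (Sigma_zkLogin Z) [pk_OP, iss, zkaddr, T] pk M \<sigma>)
   | _ \<Rightarrow> False)"

text \<open>
  \<open>(Q\<^sub>w, Q\<^sub>s)\<close>, with entries \<open>(T_exp, zkaddr, iss)\<close> and \<open>(T_exp, zkaddr, iss, m)\<close>.
\<close>

type_synonym sec_state = "(bits \<times> bits \<times> bits) set \<times> (bits \<times> bits \<times> bits \<times> bits) set"

definition sec_oracle :: "setting \<Rightarrow> nat \<Rightarrow> op_keys \<Rightarrow> bits \<Rightarrow> sec_state oracles" where
  "sec_oracle Z k K pk i q st = (case i of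
     Witness_Oracle \<Rightarrow> (case q of
         [[iss], [zkaddr], [T_exp]] \<Rightarrow> bind_pmf (GetWitness Z k K iss zkaddr T_exp) (\<lambda>r. case r of
             None \<Rightarrow> return_pmf ([], st)
           | Some (w, pk_OP) \<Rightarrow> return_pmf (w, (insert (T_exp, zkaddr, iss) (fst st), snd st)))
       | _ \<Rightarrow> return_pmf ([], st))
   | Sign_Oracle \<Rightarrow> (case q of
         [[zkaddr], [iss], [m], [T_exp]] \<Rightarrow>
           bind_pmf (zkLoginSign Z k K pk zkaddr iss m T_exp) (\<lambda>r. case r of
             None \<Rightarrow> return_pmf ([], st)
           | Some \<sigma> \<Rightarrow> return_pmf (\<sigma>, (fst st, insert (T_exp, zkaddr, iss, m) (snd st))))
       | _ \<Rightarrow> return_pmf ([], st))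
   | JWK_Directory \<Rightarrow> return_pmf (directory_answer (jwk Z K) q, st))"

definition sec_wins :: "setting \<Rightarrow> op_keys \<Rightarrow> bits \<Rightarrow> query \<Rightarrow> sec_state \<Rightarrow> bool" where
  "sec_wins Z K pk out st = (case out of
     [[zkaddr], [iss], [m], \<sigma>, [T_cur]] \<Rightarrow>
       (\<forall>T_exp. (T_exp, zkaddr, iss) \<in> fst st \<longrightarrow> time_value T_cur > time_value T_exp) \<and>
       (\<forall>T_exp. (T_exp, zkaddr, iss, m) \<in> snd st \<longrightarrow> time_value T_cur > time_value T_exp) \<and>
       zkLoginVerify Z K pk zkaddr iss m \<sigma> T_cur
   | _ \<Rightarrow> False)"

definition sec_game :: "setting \<Rightarrow> adversary \<Rightarrow> game" where
  "sec_game Z A k =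
     bind_spmf (spmf_of_pmf (op_setup Z k)) (\<lambda>K.
     bind_spmf (spmf_of_pmf (zkLoginGen Z k)) (\<lambda>pk.
     bind_spmf (run_adversary A (sec_oracle Z k K pk) k pk ({}, {})) (\<lambda>(out, st, n).
     return_spmf (sec_wins Z K pk out st, n))))"

end

theory Submission
  imports Defs
begin

text \<open>
  A zkLogin adversary is compiled to a TWS adversary that, before each oracle call, looks up the
  issuer's key in the directory and stores it in a fresh register, thereby completing the tag.
  The two runs are coupled step by step. A forgery is accepted only if
  \<open>T_cur \<le> \<sigma>.T\<close>, whereas every recorded query for the same address and issuer has
  \<open>T_exp < T_cur\<close>; hence neither a witness nor a
  signature on the message was requested for the tag with time \<open>\<sigma>.T\<close>.
\<close>

section \<open>Compiling the adversary\<close>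

text \<open>A call of the wrong shape becomes the directory query \<open>[]\<close>, which likewise
  yields the empty answer and so clears \<open>ys\<close>. Passing it on unchanged would be wrong: a
  query malformed for zkLogin can be well formed for the TWS oracles. The shape is fixed by the
  program text, so the distinction is made at compile time.\<close>

definition translate_call :: "reg \<Rightarrow> port \<Rightarrow> reg list list \<Rightarrow> reg list \<Rightarrow> cmd" where
  "translate_call z i xss ys = (case i of
     JWK_Directory \<Rightarrow> Call JWK_Directory xss ys
   | Witness_Oracle \<Rightarrow> (case xss of
         [[iss], [zkaddr], [T]] \<Rightarrow>
           Seq (Call JWK_Directory [[iss]] [z])
             (Call Witness_Oracle [[z, iss, zkaddr, T]] ys)
       | _ \<Rightarrow> Call JWK_Directory [] ys)
   | Sign_Oracle \<Rightarrow> (case xss of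
         [[zkaddr], [iss], [m], [T]] \<Rightarrow>
           Seq (Call JWK_Directory [[iss]] [z])
             (Call Sign_Oracle [[z, iss, zkaddr, T], [m]] ys)
       | _ \<Rightarrow> Call JWK_Directory [] ys))"

primrec simulate :: "reg \<Rightarrow> cmd \<Rightarrow> cmd" where
  "simulate z Skip = Skip"
| "simulate z (Push x b) = Push x b"
| "simulate z (Pop x) = Pop x"
| "simulate z (Flip x) = Flip x"
| "simulate z (Call i xss ys) = translate_call z i xss ys"
| "simulate z (Seq c d) = Seq (simulate z c) (simulate z d)"
| "simulate z (If_Then_Else b c d) = If_Then_Else b (simulate z c) (simulate z d)"
| "simulate z (While b c) = While b (simulate z c)"

text \<open>The tag takes its time from the signature, as verification does; \<open>T_cur\<close> is
  dropped. Output of any other shape never wins the zkLogin game, so it may be replaced by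
  \<open>[]\<close>.\<close>

definition reduction :: "reg \<Rightarrow> adversary \<Rightarrow> adversary" where
  "reduction z A = (case snd A of
     [[zkaddr], [iss], [m], [vk, T, \<sigma>u, \<pi>], [T_cur]] \<Rightarrow>
       (Seq (simulate z (fst A)) (Call JWK_Directory [[iss]] [z]),
        [[z, iss, zkaddr, T], [m], [vk, T, \<sigma>u, \<pi>]])
   | _ \<Rightarrow> (simulate z (fst A), []))"

primrec test_reg :: "test \<Rightarrow> reg" where
  "test_reg (Nonempty x) = x"
| "test_reg (Top x) = x"

primrec regs :: "cmd \<Rightarrow> reg set" where
  "regs Skip = {}"
| "regs (Push x b) = {x}"
| "regs (Pop x) = {x}"
| "regs (Flip x) = {x}"
| "regs (Call i xss ys) = set (concat xss) \<union> set ys"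
| "regs (Seq c d) = regs c \<union> regs d"
| "regs (If_Then_Else b c d) = insert (test_reg b) (regs c \<union> regs d)"
| "regs (While b c) = insert (test_reg b) (regs c)"

lemma finite_regs: "finite (regs c)"
  by (induction c) auto

lemma holds_cong: "s (test_reg b) = s' (test_reg b) \<Longrightarrow> holds b s = holds b s'"
  by (cases b) auto

lemma assign_cong:
  assumes "\<And>x. x \<noteq> z \<Longrightarrow> s x = s' x" "x \<noteq> z"
  shows "assign ys as s x = assign ys as s' x"
  using assms(1)
proof (induction ys as s arbitrary: s' rule: assign.induct)
  case (1 as s)
  then show ?case using assms(2) by simp
next
  case (2 y ys s)
  show ?case unfolding assign.simps by (rule "2.IH") (simp add: "2.prems")
next
  case (3 y ys a as s)
  show ?case unfolding assign.simps by (rule "3.IH") (simp add: "3.prems")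
qed

section \<open>Coupling the oracles\<close>

definition tag_of :: "op_keys \<Rightarrow> bits \<Rightarrow> bits \<Rightarrow> bits \<Rightarrow> bits list" where
  "tag_of K iss zkaddr T = [snd (K iss), iss, zkaddr, T]"

text \<open>Completing an entry with the true issuer key loses nothing: \<open>T\<close>,
  \<open>zkaddr\<close> and \<open>iss\<close> can be read off the tag, so freshness carries over to
  the image.\<close>

definition embed :: "op_keys \<Rightarrow> sec_state \<Rightarrow> tws_state" where
  "embed K st =
     ((\<lambda>(T, zkaddr, iss). tag_of K iss zkaddr T) ` fst st,
      (\<lambda>(T, zkaddr, iss, m). (tag_of K iss zkaddr T, m)) ` snd st)"

text \<open>The default \<open>[]\<close> is what the empty directory answer leaves in the key
  register for an unknown issuer.\<close>

definition lookup :: "setting \<Rightarrow> op_keys \<Rightarrow> bits \<Rightarrow> bits" where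
  "lookup Z K iss = (case jwk Z K iss of None \<Rightarrow> [] | Some pk \<Rightarrow> pk)"

lemma lookup_issuer: "iss \<in> issuers Z \<Longrightarrow> lookup Z K iss = snd (K iss)"
  by (simp add: lookup_def jwk_def)

abbreviation tws_orc :: "setting \<Rightarrow> nat \<Rightarrow> op_keys \<Rightarrow> bits \<Rightarrow> tws_state oracles" where
  "tws_orc Z k K pk \<equiv> tws_oracle (P_zkLogin Z) (Sigma_zkLogin Z) (zkLogin_env Z) k K pk"

definition honest_keys :: "setting \<Rightarrow> nat \<Rightarrow> op_keys \<Rightarrow> bool" where
  "honest_keys Z k K \<longleftrightarrow> (\<forall>iss \<in> issuers Z. K iss \<in> set_pmf (jwt_gen (jwts Z) k))"

lemma honest_keys_op_setup:
  assumes "finite (issuers Z)" "K \<in> set_pmf (op_setup Z k)"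
  shows "honest_keys Z k K"
  using assms by (auto simp: honest_keys_def op_setup_def set_Pi_pmf PiE_dflt_def)

text \<open>Correctness of tokens is perfect: under honest keys every issued token verifies and
  carries exactly the requested claims, including the nonce. Hence the predicate test in
  \<open>obtain_witness\<close> never discards a witness.\<close>

lemma GetWitness_valid:
  assumes "jwt_correct (jwts Z)" "honest_keys Z k K"
    and "Some (w, pk_OP) \<in> set_pmf (GetWitness Z k K iss zkaddr T)"
  shows "iss \<in> issuers Z" "pk_OP = snd (K iss)" "P_zkLogin Z k (tag_of K iss zkaddr T) w"
proof -
  from assms(3) obtain stid aud salt vk sk r jwt where *:
    "iss \<in> issuers Z" "pk_OP = snd (K iss)" "zkaddr = hash Z k [stid, aud, iss, salt]"
    "(vk, sk) \<in> set_pmf (sig_gen (sigs Z) k)" "w = [jwt, salt, r, vk, sk]"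
    "jwt \<in> set_pmf (jwt_issue (jwts Z) (fst (K iss))
       \<lparr>cl_stid = stid, cl_aud = aud, cl_iss = iss, cl_nonce = hash Z k [vk, T, r]\<rparr>)"
    by (auto simp: GetWitness_def jwk_def split: option.splits if_splits)
  show "iss \<in> issuers Z" "pk_OP = snd (K iss)" using * by auto
  have "(fst (K iss), snd (K iss)) \<in> set_pmf (jwt_gen (jwts Z) k)"
    using assms(2) *(1) by (simp add: honest_keys_def)
  with assms(1) *(6) have
    "jwt_verify (jwts Z) (snd (K iss)) jwt \<and> jwt_claims (jwts Z) jwt =
       \<lparr>cl_stid = stid, cl_aud = aud, cl_iss = iss, cl_nonce = hash Z k [vk, T, r]\<rparr>"
    unfolding jwt_correct_def by fast
  with * show "P_zkLogin Z k (tag_of K iss zkaddr T) w"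
    by (simp add: P_zkLogin_def tag_of_def)
qed

text \<open>For a trusted issuer the tag is meaningful and the predicate test is vacuous. For an
  unknown issuer no key makes the tag meaningful, and \<open>GetWitness\<close> fails as
  well.\<close>

lemma obtain_witness_eq:
  assumes "jwt_correct (jwts Z)" "honest_keys Z k K"
  shows "obtain_witness (P_zkLogin Z) (zkLogin_env Z) k K [lookup Z K iss, iss, zkaddr, T] =
    map_pmf (map_option fst) (GetWitness Z k K iss zkaddr T)"
proof (cases "iss \<in> issuers Z")
  case True
  have "map_pmf (\<lambda>r. case r of None \<Rightarrow> None
          | Some w \<Rightarrow> if P_zkLogin Z k [snd (K iss), iss, zkaddr, T] w then Some w else None)
          (map_pmf (map_option fst) (GetWitness Z k K iss zkaddr T)) =
        map_pmf (map_option fst) (GetWitness Z k K iss zkaddr T)"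
    unfolding pmf.map_comp
    by (rule pmf.map_cong0) (auto split: option.splits dest: GetWitness_valid(3)[OF assms, unfolded tag_of_def])
  with True show ?thesis
    by (simp add: obtain_witness_def zkLogin_env_def zkLogin_tag_def zkLogin_witness_def jwk_def
        lookup_issuer)
next
  case False
  then show ?thesis
    by (simp add: obtain_witness_def zkLogin_env_def zkLogin_tag_def jwk_def GetWitness_def)
qed

text \<open>Both sides draw the witness from the same distribution. An entry is added only on
  success, hence for a trusted issuer, whose looked-up key is the one used by
  \<open>embed\<close>.\<close>

lemma witness_oracle_eq:
  assumes "jwt_correct (jwts Z)" "honest_keys Z k K"
  shows "tws_orc Z k K pk Witness_Oracle [[lookup Z K iss, iss, zkaddr, T]] (embed K st) =
    map_pmf (map_prod id (embed K)) (sec_oracle Z k K pk Witness_Oracle [[iss], [zkaddr], [T]] st)"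
  unfolding tws_oracle_def sec_oracle_def
  by (auto simp: obtain_witness_eq[OF assms] map_bind_pmf bind_map_pmf embed_def tag_of_def
      lookup_issuer GetWitness_valid(1)[OF assms] intro!: bind_pmf_cong split: option.splits)

lemma sign_oracle_eq:
  assumes "jwt_correct (jwts Z)" "honest_keys Z k K"
  shows "tws_orc Z k K pk Sign_Oracle [[lookup Z K iss, iss, zkaddr, T], [m]] (embed K st) =
    map_pmf (map_prod id (embed K))
      (sec_oracle Z k K pk Sign_Oracle [[zkaddr], [iss], [m], [T]] st)"
proof -
  \<comment> \<open>The key returned with the witness is the one in the tag, so both sides run the
    same signing algorithm on the same arguments.\<close>
  have valid: "iss \<in> issuers Z \<and> pk_OP = snd (K iss)"
    if "Some (w, pk_OP) \<in> set_pmf (GetWitness Z k K iss zkaddr T)" for w pk_OP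
    using GetWitness_valid(1,2)[OF assms that] by blast
  show ?thesis
    unfolding tws_oracle_def sec_oracle_def zkLoginSign_def
    by (auto simp: obtain_witness_eq[OF assms] map_bind_pmf bind_map_pmf bind_assoc_pmf
        bind_return_pmf embed_def tag_of_def lookup_issuer
        dest!: valid intro!: bind_pmf_cong split: option.splits)
qed

lemma directory_oracle_eq:
  "tws_orc Z k K pk JWK_Directory q (embed K st) =
    map_pmf (map_prod id (embed K)) (sec_oracle Z k K pk JWK_Directory q st)"
  by (simp add: tws_oracle_def sec_oracle_def zkLogin_env_def)

lemma exec_directory_lookup:
  "exec (tws_orc Z k K pk) (Call JWK_Directory [[i]] [z]) (s, st, n) =
    return_spmf (s(z := lookup Z K (s i)), st, n + 1 + length (s i))"
  by (simp add: tws_oracle_def zkLogin_env_def directory_answer_def lookup_def total_length_def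
      split: option.split)

section \<open>Coupling the executions\<close>

lemma while_spmf_invariant:
  assumes inv: "\<And>x y. P x \<Longrightarrow> g x \<Longrightarrow> y \<in> set_spmf (f x) \<Longrightarrow> P y" and "P x"
  shows "set_spmf (while_spmf g f x) \<subseteq> {y. P y}"
proof -
  have "\<forall>x. P x \<longrightarrow> set_spmf (while_spmf g f x) \<subseteq> {y. P y}"
  proof (rule while_spmf.fixp_induct[of "\<lambda>W. \<forall>x. P x \<longrightarrow> set_spmf (W x) \<subseteq> {y. P y}"])
    show "spmf.admissible (\<lambda>W. \<forall>x. P x \<longrightarrow> set_spmf (W x) \<subseteq> {y. P y})"
      by simp
  qed (use inv in \<open>fastforce simp: set_bind_spmf bind_UNION split: if_splits\<close>)+
  with \<open>P x\<close> show ?thesis by blast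
qed

text \<open>Both loops are least fixed points. Each inequality follows by fixpoint induction on the
  smaller side and one unfolding of the other; the invariant \<open>P\<close> is carried along
  because \<open>h\<close> commutes with the body only there.\<close>

lemma map_while_spmf:
  assumes guard: "\<And>x. P x \<Longrightarrow> g x = g' (h x)"
    and body: "\<And>x. P x \<Longrightarrow> g x \<Longrightarrow> map_spmf h (f x) = f' (h x)"
    and inv: "\<And>x y. P x \<Longrightarrow> g x \<Longrightarrow> y \<in> set_spmf (f x) \<Longrightarrow> P y"
    and "P x"
  shows "map_spmf h (while_spmf g f x) = while_spmf g' f' (h x)"
proof (rule spmf.leq_antisym)
  have eq: "f' (h x) \<bind> W = f x \<bind> (\<lambda>y. W (h y))" if "P x" "g x" for x and W :: "'b \<Rightarrow> 'b spmf"
    by (simp add: body[OF that, symmetric] bind_map_spmf o_def)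
  have "\<forall>x. P x \<longrightarrow> ord_spmf (=) (map_spmf h (while_spmf g f x)) (while_spmf g' f' (h x))"
  proof (rule while_spmf.fixp_induct[of "\<lambda>W. \<forall>x. P x \<longrightarrow>
        ord_spmf (=) (map_spmf h (W x)) (while_spmf g' f' (h x))"])
    show "spmf.admissible (\<lambda>W. \<forall>x. P x \<longrightarrow>
        ord_spmf (=) (map_spmf h (W x)) (while_spmf g' f' (h x)))"
      by simp
  next
    fix W assume "\<forall>x. P x \<longrightarrow> ord_spmf (=) (map_spmf h (W x)) (while_spmf g' f' (h x))"
    then show "\<forall>x. P x \<longrightarrow> ord_spmf (=) (map_spmf h (if g x then f x \<bind> W else return_spmf x))
        (while_spmf g' f' (h x))"
      by (subst while_spmf.simps)
        (auto simp: guard[symmetric] eq map_spmf_bind_spmf o_def intro: inv intro!: ord_spmf_bind_reflI)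
  qed simp
  with \<open>P x\<close> show "ord_spmf (=) (map_spmf h (while_spmf g f x)) (while_spmf g' f' (h x))" by blast
  have "\<forall>x. P x \<longrightarrow> ord_spmf (=) (while_spmf g' f' (h x)) (map_spmf h (while_spmf g f x))"
  proof (rule while_spmf.fixp_induct[of "\<lambda>W. \<forall>x. P x \<longrightarrow>
        ord_spmf (=) (W (h x)) (map_spmf h (while_spmf g f x))"])
    show "spmf.admissible (\<lambda>W. \<forall>x. P x \<longrightarrow>
        ord_spmf (=) (W (h x)) (map_spmf h (while_spmf g f x)))"
      by simp
  next
    fix W assume "\<forall>x. P x \<longrightarrow> ord_spmf (=) (W (h x)) (map_spmf h (while_spmf g f x))"
    then show "\<forall>x. P x \<longrightarrow> ord_spmf (=) (if g' (h x) then f' (h x) \<bind> W else return_spmf (h x))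
        (map_spmf h (while_spmf g f x))"
      by (subst while_spmf.simps)
        (auto simp: guard[symmetric] eq map_spmf_bind_spmf o_def intro: inv intro!: ord_spmf_bind_reflI)
  qed simp
  with \<open>P x\<close> show "ord_spmf (=) (while_spmf g' f' (h x)) (map_spmf h (while_spmf g f x))" by blast
qed

text \<open>
  Parallel fixpoint induction would need admissibility of \<^const>\<open>rel_spmf\<close>, which rests on
  Strassen's theorem. Instead, couplings of the bodies are chosen and iterated by a loop on pairs.
\<close>

lemma while_spmf_transfer:
  assumes guard: "\<And>x y. R x y \<Longrightarrow> g x = g' y"
    and body: "\<And>x y. R x y \<Longrightarrow> g x \<Longrightarrow> rel_spmf R (f x) (f' y)"
    and "R x y"
  shows "rel_spmf R (while_spmf g f x) (while_spmf g' f' y)"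
proof -
  \<comment> \<open>The premises stand inside the existential so that choice yields a total function
    \<open>J\<close>.\<close>
  have "\<exists>pq. R x y \<and> g x \<longrightarrow>
      (\<forall>z \<in> set_spmf pq. case_prod R z) \<and> map_spmf fst pq = f x \<and> map_spmf snd pq = f' y" for x y
    using body[of x y] unfolding rel_spmf_simps by blast
  then obtain J where J: "\<And>x y. R x y \<Longrightarrow> g x \<Longrightarrow>
      (\<forall>z \<in> set_spmf (J x y). case_prod R z) \<and>
      map_spmf fst (J x y) = f x \<and> map_spmf snd (J x y) = f' y"
    by metis
  let ?W = "while_spmf (\<lambda>(x, y). g x) (\<lambda>(x, y). J x y)"
  have inv: "case_prod R v" if "case_prod R z" "case_prod (\<lambda>x y. g x) z"
    "v \<in> set_spmf (case_prod J z)" for z v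
    using that J by (cases z) auto
  \<comment> \<open>The loop on pairs is itself the required coupling: \<open>R\<close> is an
    invariant of it, and its two projections are the given loops.\<close>
  show ?thesis
  proof (rule rel_spmfI)
    show "R u v" if "(u, v) \<in> set_spmf (?W (x, y))" for u v
      using subsetD[OF while_spmf_invariant[where P = "case_prod R" and x = "(x, y)", OF inv] that] \<open>R x y\<close> by auto
    show "map_spmf fst (?W (x, y)) = while_spmf g f x"
      by (subst map_while_spmf[of "case_prod R", OF _ _ inv]) (use J \<open>R x y\<close> in auto)
    show "map_spmf snd (?W (x, y)) = while_spmf g' f' y"
      by (subst map_while_spmf[of "case_prod R", OF _ _ inv]) (use J \<open>R x y\<close> guard in auto)
  qed
qed

text \<open>\<open>D\<close> bounds the slowdown: each oracle call additionally costs a lookup and writing its answer.\<close>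

definition sim_rel :: "reg \<Rightarrow> op_keys \<Rightarrow> nat \<Rightarrow> sec_state conf \<Rightarrow> tws_state conf \<Rightarrow> bool" where
  "sim_rel z K D = (\<lambda>(s, st, n) (s', st', n').
     (\<forall>x. x \<noteq> z \<longrightarrow> s x = s' x) \<and> st' = embed K st \<and> n' \<le> D * n)"

section \<open>Calls and whole programs, with time bounds\<close>

lemma total_length_simps [simp]:
  "total_length [] = 0" "total_length (q # qs) = sum_list (map length q) + total_length qs"
  by (simp_all add: total_length_def)

text \<open>Both answers come from one distribution up to \<open>embed\<close>, so the diagonal
  coupling works. Port and query may differ, since the compiled query carries the key or is a
  dummy.\<close>

lemma call_coupling:
  assumes "tws_orc Z k K pk i' q' (embed K st) =
      map_pmf (map_prod id (embed K)) (sec_oracle Z k K pk i q st)"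
    and "\<And>x. x \<noteq> z \<Longrightarrow> s x = s' x" and "n' \<le> D * n"
  shows "rel_spmf (sim_rel z K D)
      (map_spmf (\<lambda>(as, st'). (assign ys as s, st', n)) (spmf_of_pmf (sec_oracle Z k K pk i q st)))
      (map_spmf (\<lambda>(as, st'). (assign ys as s', st', n'))
        (spmf_of_pmf (tws_orc Z k K pk i' q' (embed K st))))"
proof -
  have "assign ys as s x = assign ys as s' x" if "x \<noteq> z" for as x
    using assms(2) that by (rule assign_cong)
  then show ?thesis
    using assms(3) unfolding assms(1)
    by (auto simp: spmf_rel_map pmf.rel_map sim_rel_def intro!: rel_pmf_reflI)
qed

lemma malformed_call:
  assumes "\<And>as st. sec_oracle Z k K pk i q st = return_pmf ([], st)"
  shows "tws_orc Z k K pk JWK_Directory [] (embed K st) =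
      map_pmf (map_prod id (embed K)) (sec_oracle Z k K pk i q st)"
  by (simp add: assms tws_oracle_def directory_answer_def)

text \<open>Here \<open>w\<close> is the length of the key, the \<open>2\<close> pays for two
  instructions, and \<open>l \<le> 2 * L\<close> allows each argument to be written twice. The
  summand \<open>D\<close> covers \<open>w + 2\<close>, and \<open>D * L\<close> covers
  \<open>l\<close>.\<close>

lemma call_cost:
  fixes n :: nat
  assumes "n' \<le> D * n" "w + 2 \<le> D" "l \<le> 2 * L"
  shows "n' + 2 + l + w \<le> D * (n + 1 + L)"
proof -
  have "2 * L \<le> D * L"
    using assms(2) by (intro mult_right_mono) auto
  then have "n' + 2 + l + w \<le> D * n + D + D * L"
    using assms by linarith
  then show ?thesis by (simp add: algebra_simps)
qed

lemma translate_call_coupling: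
  assumes J: "jwt_correct (jwts Z)" "honest_keys Z k K"
    and D: "\<And>iss. length (lookup Z K iss) + 2 \<le> D"
    and z: "z \<notin> regs (Call i xss ys)"
    and R: "sim_rel z K D x y"
  shows "rel_spmf (sim_rel z K D) (exec (sec_oracle Z k K pk) (Call i xss ys) x)
      (exec (tws_orc Z k K pk) (translate_call z i xss ys) y)"
proof -
  obtain s st n s' n' where xy: "x = (s, st, n)" "y = (s', embed K st, n')"
    and s: "\<And>x. x \<noteq> z \<Longrightarrow> s x = s' x" and n: "n' \<le> D * n"
    using R by (cases x; cases y) (auto simp: sim_rel_def)
  have regs: "s' r = s r" if "r \<in> set (concat xss)" for r
    using z that s by (metis UnI1 regs.simps(5))
  have q: "map (map s') xss = map (map s) xss"
    using regs by auto
  have cost: "l \<le> 2 * L \<Longrightarrow> n' + 2 + l + length (lookup Z K iss) \<le> D * (n + 1 + L)" for l L iss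
    by (rule call_cost[OF n D])
  \<comment> \<open>Both sides answer \<open>[]\<close> and leave the records alone; the dummy query
    costs a single unit.\<close>
  have bad: ?thesis if "translate_call z i xss ys = Call JWK_Directory [] ys"
    and "\<And>st. sec_oracle Z k K pk i (map (map s) xss) st = return_pmf ([], st)"
    unfolding that(1) xy exec.simps Let_def prod.case list.map
    by (rule call_coupling[OF malformed_call[OF that(2)] s])
      (use cost[of 0 "total_length (map (map s) xss)" "[]"] in simp_all)
  show ?thesis
  proof (cases i)
    case JWK_Directory
    then show ?thesis
      unfolding xy translate_call_def exec.simps Let_def prod.case port.case q
      by (simp only: port.case exec.simps Let_def prod.case q)
        (rule call_coupling[OF directory_oracle_eq s],
         use cost[of "total_length (map (map s) xss)" "total_length (map (map s) xss)" "[]"] in simp_all)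
  next
    case Witness_Oracle
    show ?thesis
    proof (cases "\<exists>a b t. xss = [[a], [b], [t]]")
      case True
      then obtain a b t where xss: "xss = [[a], [b], [t]]" by blast
      \<comment> \<open>By freshness of \<open>z\<close>, storing the key leaves the argument
        registers intact.\<close>
      have r: "a \<noteq> z" "b \<noteq> z" "t \<noteq> z" using z xss by auto
      show ?thesis
        unfolding xy Witness_Oracle xss translate_call_def
        apply (simp only: port.case list.case exec.simps(6) exec_directory_lookup return_bind_spmf)
        apply (simp only: exec.simps Let_def prod.case list.map)
        apply (simp only: fun_upd_same fun_upd_other[OF r(1)] fun_upd_other[OF r(2)]
            fun_upd_other[OF r(3)] s[OF r(1)] s[OF r(2)] s[OF r(3)])
        apply (rule call_coupling[OF witness_oracle_eq[OF J]])
        subgoal using s by simp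
        \<comment> \<open>The issuer in \<open>a\<close> counts twice in \<open>l\<close>: once for
          the lookup, once within the tag.\<close>
        subgoal
          using cost[where iss = "s' a" and l = "length (s' a) + length (s' a) + length (s' b) + length (s' t)"
              and L = "length (s' a) + length (s' b) + length (s' t)"] by (simp add: add_ac)
        done
    next
      case False
      show ?thesis
        by (rule bad) (use False in \<open>auto simp: Witness_Oracle translate_call_def sec_oracle_def
              Cons_eq_map_conv split: list.splits\<close>)
    qed
  next
    case Sign_Oracle
    show ?thesis
    proof (cases "\<exists>b a m t. xss = [[b], [a], [m], [t]]")
      case True
      then obtain b a m t where xss: "xss = [[b], [a], [m], [t]]" by blast
      have r: "a \<noteq> z" "b \<noteq> z" "m \<noteq> z" "t \<noteq> z" using z xss by auto
      show ?thesis
        unfolding xy Sign_Oracle xss translate_call_def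
        apply (simp only: port.case list.case exec.simps(6) exec_directory_lookup return_bind_spmf)
        apply (simp only: exec.simps Let_def prod.case list.map)
        apply (simp only: fun_upd_same fun_upd_other[OF r(1)] fun_upd_other[OF r(2)]
            fun_upd_other[OF r(3)] fun_upd_other[OF r(4)]
            s[OF r(1)] s[OF r(2)] s[OF r(3)] s[OF r(4)])
        apply (rule call_coupling[OF sign_oracle_eq[OF J]])
        subgoal using s by simp
        subgoal
          using cost[where iss = "s' a" and l = "length (s' a) + length (s' a) + length (s' b) + length (s' m) + length (s' t)"
              and L = "length (s' a) + length (s' b) + length (s' m) + length (s' t)"] by (simp add: add_ac)
        done
    next
      case False
      show ?thesis
        by (rule bad) (use False in \<open>auto simp: Sign_Oracle translate_call_def sec_oracle_def
              Cons_eq_map_conv split: list.splits\<close>)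
    qed
  qed
qed

lemma sim_rel_tick:
  assumes "1 \<le> D" "sim_rel z K D (s, st, n) (s', st', n')"
  shows "sim_rel z K D (s, st, n + 1) (s', st', n' + 1)"
  using assms by (auto simp: sim_rel_def)

text \<open>Induction on the program. Tests never read \<open>z\<close>, so both runs take the same
  branches; only calls are changed, and every other unit of time is covered by
  \<open>1 \<le> D\<close>.\<close>

lemma simulate_coupling:
  assumes J: "jwt_correct (jwts Z)" "honest_keys Z k K"
    and D: "\<And>iss. length (lookup Z K iss) + 2 \<le> D"
  shows "z \<notin> regs c \<Longrightarrow> sim_rel z K D x y \<Longrightarrow>
    rel_spmf (sim_rel z K D) (exec (sec_oracle Z k K pk) c x) (exec (tws_orc Z k K pk) (simulate z c) y)"
proof (induction c arbitrary: x y)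
  case (Call i xss ys)
  then show ?case using translate_call_coupling[OF J D] by simp
next
  case (Seq c d)
  then show ?case
    unfolding exec.simps simulate.simps by (intro rel_spmf_bindI[OF Seq.IH(1)]) auto
next
  have D1: "1 \<le> D" using D[of "[]"] by simp
  {
    case (If_Then_Else b c d)
    obtain s st n s' st' n' where xy: "x = (s, st, n)" "y = (s', st', n')"
      by (cases x; cases y)
    have "holds b s = holds b s'"
      using If_Then_Else.prems by (intro holds_cong) (auto simp: xy sim_rel_def)
    then show ?case
      using If_Then_Else sim_rel_tick[OF D1] by (simp add: xy)
  next
    case (While b c)
    show ?case
      unfolding exec.simps simulate.simps spmf_rel_map
    proof (rule rel_spmf_mono[OF while_spmf_transfer[where R = "sim_rel z K D"]])
      show "sim_rel z K D x y" by fact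
    next
      fix x y :: "(reg \<Rightarrow> bits) \<times> _ \<times> nat"
      assume "sim_rel z K D x y"
      moreover have "test_reg b \<noteq> z" using While.prems by auto
      ultimately show "(case x of (s, st, n) \<Rightarrow> holds b s) = (case y of (s, st, n) \<Rightarrow> holds b s)"
        by (auto simp: sim_rel_def intro!: holds_cong)
    next
      fix x y :: "(reg \<Rightarrow> bits) \<times> _ \<times> nat"
      assume "sim_rel z K D x y"
      then show "rel_spmf (sim_rel z K D)
          (case x of (s, st, n) \<Rightarrow> exec (sec_oracle Z k K pk) c (s, st, n + 1))
          (case y of (s, st, n) \<Rightarrow> exec (tws_orc Z k K pk) (simulate z c) (s, st, n + 1))"
        using While sim_rel_tick[OF D1] by (cases x; cases y) auto
    next
      fix x y :: "(reg \<Rightarrow> bits) \<times> _ \<times> nat"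
      assume "sim_rel z K D x y"
      then show "sim_rel z K D (case x of (s, st, n) \<Rightarrow> (s, st, n + 1))
          (case y of (s, st, n) \<Rightarrow> (s, st, n + 1))"
        using sim_rel_tick[OF D1] by (cases x; cases y) auto
    qed
  next
    case Skip
    then show ?case using D1 by (auto simp: sim_rel_def)
  next
    case (Push r b)
    then show ?case using D1 by (auto simp: sim_rel_def)
  next
    case (Pop r)
    then show ?case using D1 by (auto simp: sim_rel_def)
  next
    case (Flip r)
    then show ?case
      using D1 by (auto simp: sim_rel_def spmf_rel_map intro!: rel_spmf_reflI)
  }
qed

section \<open>Coupling the games\<close>

text \<open>The time string \<open>T\<close> of the signature instantiates the quantifiers of both
  expiry conditions: were it recorded, \<open>T_cur\<close> would exceed it, against the check in
  verification. Acceptance also forces a trusted issuer, so the tag is meaningful.\<close>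

lemma sec_wins_imp_tws_wins:
  assumes "sec_wins Z K pk [[zkaddr], [iss], [m], [vk, T, \<sigma>u, \<pi>], [T_cur]] st"
  shows "tws_wins (Sigma_zkLogin Z) (zkLogin_env Z) K pk
    [[lookup Z K iss, iss, zkaddr, T], [m], [vk, T, \<sigma>u, \<pi>]] (embed K st)"
proof -
  have iss: "jwk Z K iss = Some (lookup Z K iss)" "lookup Z K iss = snd (K iss)"
    and verify: "tws_verify (Sigma_zkLogin Z) [lookup Z K iss, iss, zkaddr, T] pk m [vk, T, \<sigma>u, \<pi>]"
    and "(T, zkaddr, iss) \<notin> fst st" "(T, zkaddr, iss, m) \<notin> snd st"
    using assms
    by (auto simp: sec_wins_def zkLoginVerify_def lookup_def jwk_def split: option.splits if_splits)
  then show ?thesis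
    by (auto simp: tws_wins_def zkLogin_env_def zkLogin_tag_def embed_def tag_of_def)
qed

text \<open>Winning transfers in one direction only, as the compiled forgery forgets
  \<open>T_cur\<close>. The extra \<open>1\<close> in the time bound pays for the final
  lookup.\<close>

lemma run_coupling:
  assumes J: "jwt_correct (jwts Z)" "honest_keys Z k K"
    and D: "\<And>iss. length (lookup Z K iss) + 2 \<le> D"
    and z: "z \<notin> regs (fst A) \<union> set (concat (snd A))"
  shows "rel_spmf (\<lambda>(out, st, n) (out', st', n').
      (sec_wins Z K pk out st \<longrightarrow>
        tws_wins (Sigma_zkLogin Z) (zkLogin_env Z) K pk out' st') \<and> n' \<le> D * (n + 1))
    (run_adversary A (sec_oracle Z k K pk) k pk ({}, {}))
    (run_adversary (reduction z A) (tws_orc Z k K pk) k pk ({}, {}))"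
proof -
  have c: "rel_spmf (sim_rel z K D)
      (exec (sec_oracle Z k K pk) (fst A) (init_regs k pk, ({}, {}), 0))
      (exec (tws_orc Z k K pk) (simulate z (fst A)) (init_regs k pk, ({}, {}), 0))"
    using z by (intro simulate_coupling[OF J D]) (auto simp: sim_rel_def embed_def)
  show ?thesis
  proof (cases "\<exists>a i m v t u p tc. snd A = [[a], [i], [m], [v, t, u, p], [tc]]")
    case True
    then obtain a i m v t u p tc where A: "snd A = [[a], [i], [m], [v, t, u, p], [tc]]" by blast
    have r: "a \<noteq> z" "i \<noteq> z" "m \<noteq> z" "v \<noteq> z" "t \<noteq> z" "u \<noteq> z" "p \<noteq> z" "tc \<noteq> z"
      using z A by auto
    have B: "reduction z A = (Seq (simulate z (fst A)) (Call JWK_Directory [[i]] [z]),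
        [[z, i, a, t], [m], [v, t, u, p]])"
      by (simp add: reduction_def A)
    have E: "exec (tws_orc Z k K pk) (Seq (simulate z (fst A)) (Call JWK_Directory [[i]] [z])) x =
        map_spmf (\<lambda>(s, st, n). (s(z := lookup Z K (s i)), st, n + 1 + length (s i)))
          (exec (tws_orc Z k K pk) (simulate z (fst A)) x)" for x
      unfolding exec.simps(6) map_spmf_conv_bind_spmf
      by (rule bind_spmf_cong) (auto simp only: exec_directory_lookup prod.case)
    \<comment> \<open>The issuer is written for the lookup and in the tag, the time in the tag and
      in the signature, hence the factor two. The subtracted key length is a summand of
      \<open>?l\<close>, so the subtraction does not truncate.\<close>
    have cost: "n' + 1 + length (s i) + (length (lookup Z K (s i)) + length (s i) + length (s a) +
        length (s t) + length (s m) + length (s v) + length (s t) + length (s u) + length (s p))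
        \<le> D * (n + (length (s a) + length (s i) + length (s m) + length (s v) + length (s t) +
             length (s u) + length (s p) + length (s tc)) + 1)" (is "_ + ?l \<le> D * (n + ?L + 1)")
      if "n' \<le> D * n" for s :: "reg \<Rightarrow> bits" and n n'
      using call_cost[OF that D[of "s i"], of "?l + length (s i) - length (lookup Z K (s i))" ?L]
      by simp
    show ?thesis
      unfolding run_adversary_def B fst_conv snd_conv E spmf_rel_map A
    proof (rule rel_spmf_mono[OF c], goal_cases)
      case (1 x y)
      then obtain s st n s' n' where xy: "x = (s, st, n)" "y = (s', embed K st, n')"
        and s: "\<And>x. x \<noteq> z \<Longrightarrow> s' x = s x" and n: "n' \<le> D * n"
        by (cases x; cases y) (auto simp: sim_rel_def)
      show ?case
        using cost[OF n, of s] r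
        by (auto simp: xy s add_ac intro: sec_wins_imp_tws_wins)
    qed
  next
    case False
    have B: "reduction z A = (simulate z (fst A), [])"
      using False by (auto simp: reduction_def split: list.splits)
    \<comment> \<open>Evaluating registers preserves the shape of the output tuple, so a wrong shape
      loses in every run.\<close>
    have lose: "\<not> sec_wins Z K pk (map (map s) (snd A)) st" for s st
      using False
      by (auto simp: sec_wins_def zkLoginVerify_def Cons_eq_map_conv split: list.splits)
    show ?thesis
      unfolding run_adversary_def B fst_conv snd_conv spmf_rel_map
      by (rule rel_spmf_mono[OF c])
        (auto simp: sim_rel_def lose Let_def algebra_simps)
  qed
qed

lemma game_coupling:
  assumes "admissible Z"
    and D: "\<And>sk pk. (sk, pk) \<in> set_pmf (jwt_gen (jwts Z) k) \<Longrightarrow> length pk + 2 \<le> D" "2 \<le> D"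
    and z: "z \<notin> regs (fst A) \<union> set (concat (snd A))"
  shows "rel_spmf (\<lambda>(b, n) (b', n'). (b \<longrightarrow> b') \<and> n' \<le> D * (n + 1))
    (sec_game Z A k)
    (euf_ctma_game (P_zkLogin Z) (Sigma_zkLogin Z) (zkLogin_env Z) (reduction z A) k)"
proof -
  have J: "jwt_correct (jwts Z)" and fin: "finite (issuers Z)"
    using assms(1) by (auto simp: admissible_def)
  have simps: "env_setup (zkLogin_env Z) = op_setup Z" "tws_gen (Sigma_zkLogin Z) = zkLoginGen Z"
    by (auto simp: zkLogin_env_def zkLoginGen_def)
  show ?thesis
    unfolding sec_game_def euf_ctma_game_def simps
  proof (intro rel_spmf_bind_reflI)
    fix K pk
    assume "K \<in> set_spmf (spmf_of_pmf (op_setup Z k))"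
    then have K: "honest_keys Z k K" using honest_keys_op_setup[OF fin] by simp
    \<comment> \<open>For an unknown issuer the looked-up key is empty and \<open>2 \<le> D\<close>
      suffices.\<close>
    have "length (lookup Z K iss) + 2 \<le> D" for iss
      using K D by (cases "K iss") (auto simp: honest_keys_def lookup_def jwk_def)
    from run_coupling[OF J K this z] show "rel_spmf (\<lambda>(b, n) (b', n'). (b \<longrightarrow> b') \<and> n' \<le> D * (n + 1))
        (run_adversary A (sec_oracle Z k K pk) k pk ({}, {}) \<bind>
          (\<lambda>(out, st, n). return_spmf (sec_wins Z K pk out st, n)))
        (run_adversary (reduction z A) (tws_orc Z k K pk) k pk ({}, {}) \<bind>
          (\<lambda>(out, st, n). return_spmf (tws_wins (Sigma_zkLogin Z) (zkLogin_env Z) K pk out st, n)))"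
      by (rule rel_spmf_bindI) auto
  qed
qed

section \<open>Negligible functions and the final estimate\<close>

lemma negligible_mono:
  assumes "negligible g" "\<And>k. 0 \<le> f k" "\<And>k. f k \<le> g k"
  shows "negligible f"
  unfolding negligible_def
proof
  fix c
  have "eventually (\<lambda>k. \<bar>g k\<bar> < 1 / real k ^ c) sequentially"
    using assms(1) by (simp add: negligible_def)
  then show "eventually (\<lambda>k. \<bar>f k\<bar> < 1 / real k ^ c) sequentially"
    by eventually_elim (use assms(2,3) in \<open>smt (verit)\<close>)
qed

lemma win_prob_mono:
  assumes "rel_spmf (\<lambda>(b, n) (b', n'). (b \<longrightarrow> b') \<and> Q n n') (G k) (G' k)"
  shows "win_prob G k \<le> win_prob G' k"
proof -
  have "rel_spmf (\<longrightarrow>) (map_spmf fst (G k)) (map_spmf fst (G' k))"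
    unfolding spmf_rel_map by (rule rel_spmf_mono[OF assms]) auto
  moreover have "{y. \<exists>x\<in>{True}. x \<longrightarrow> y} = {True}" by auto
  ultimately show ?thesis
    using rel_spmf_measureD[of "(\<longrightarrow>)" "map_spmf fst (G k)" "map_spmf fst (G' k)" "{True}"]
    by (simp only: win_prob_def spmf_conv_measure_spmf)
qed

theorem theorem3:
  fixes Z :: setting
  assumes "admissible Z"
    and "secure (euf_ctma_game (P_zkLogin Z) (Sigma_zkLogin Z) (zkLogin_env Z))"
  shows "secure (sec_game Z)"
  unfolding secure_def
proof (intro allI impI)
  fix A
  assume "poly_time (sec_game Z A)"
  then obtain p where p: "\<And>k. lossless_spmf (sec_game Z A k)"
      "\<And>k b n. (b, n) \<in> set_spmf (sec_game Z A k) \<Longrightarrow> n \<le> poly p k"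
    unfolding poly_time_def by fast
  obtain q where q: "\<And>k sk pk. (sk, pk) \<in> set_pmf (jwt_gen (jwts Z) k) \<Longrightarrow> length pk \<le> poly q k"
    using assms(1) unfolding admissible_def jwt_short_keys_def by fast
  obtain z where z: "z \<notin> regs (fst A) \<union> set (concat (snd A))"
    using ex_new_if_finite[OF infinite_UNIV_nat] finite_regs by (metis List.finite_set finite_UnI)
  define G where
    "G = euf_ctma_game (P_zkLogin Z) (Sigma_zkLogin Z) (zkLogin_env Z) (reduction z A)"
  \<comment> \<open>The slowdown factor is the bound on key length plus the two instructions a call
    compiles to.\<close>
  have c: "rel_spmf (\<lambda>(b, n) (b', n'). (b \<longrightarrow> b') \<and> n' \<le> (poly q k + 2) * (n + 1))
      (sec_game Z A k) (G k)" for k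
    unfolding G_def by (rule game_coupling[OF assms(1) _ _ z]) (use q in auto)
  have "poly_time G"
    unfolding poly_time_def
  proof (intro exI[of _ "(q + [:2:]) * (p + [:1:])"] allI conjI ballI)
    fix k
    \<comment> \<open>A coupling preserves total mass, so almost sure termination is
      inherited.\<close>
    show "lossless_spmf (G k)"
      using rel_spmf_weightD[OF c[of k]] p(1)[of k] by (simp add: lossless_spmf_def)
    fix x
    assume "x \<in> set_spmf (G k)"
    \<comment> \<open>Every possible outcome of \<open>G\<close> is paired with one of the zkLogin
      game, whose time is at most \<open>poly p k\<close>.\<close>
    then obtain y where "y \<in> set_spmf (sec_game Z A k)"
      "(case y of (b, n) \<Rightarrow> \<lambda>(b', n'). (b \<longrightarrow> b') \<and> n' \<le> (poly q k + 2) * (n + 1)) x"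
      using rel_setD2[OF rel_funD[OF set_spmf_parametric c]] by blast
    then obtain b n b' n' where "(b, n) \<in> set_spmf (sec_game Z A k)"
      "x = (b', n')" "n' \<le> (poly q k + 2) * (n + 1)"
      by (cases x; cases y) auto
    moreover from this have "(poly q k + 2) * (n + 1) \<le> (poly q k + 2) * (poly p k + 1)"
      using p(2) by (intro mult_left_mono) auto
    ultimately show "case x of (b, n) \<Rightarrow> n \<le> poly ((q + [:2:]) * (p + [:1:])) k"
      by simp
  qed
  then have "negligible (win_prob G)"
    using assms(2) unfolding secure_def G_def by blast
  then show "negligible (win_prob (sec_game Z A))"
    by (rule negligible_mono) (use win_prob_mono[where G = "sec_game Z A" and G' = G, OF c] in \<open>simp_all add: win_prob_def\<close>)
qed

end
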